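(* Let $f:X\to X$ be a pointwise periodic homeomorphism of a compact metric space $X$. Then the set of almost periodic points of the induced map $2^f:2^X\to 2^X$ coincides with its set of uniformly recurrent points: $AP(2^f)=UR(2^f)$.
   Context: $f$ is pointwise periodic if for every $x\in X$ there is an integer $n\geq 1$ with $f^n(x)=x$. $2^X$ is the space of nonempty closed subsets of $X$ with the Hausdorff metric, and $2^f(A)=f(A)$. For a continuous self-map $g$ of a compact metric space $Z$: a point $z$ is almost periodic if for every neighborhood $U$ of $z$ there exists $N\in\mathbb{N}$ such that $\{g^{n+i}(z): i=0,1,\dots,N\}\cap U\neq\emptyset$ for all integers $n\geq 0$; a point $z$ is uniformly recurrent if for every neighborhood $U$ of $z$ there is an integer $N\geq 1$ such that $g^{kN}(z)\in U$ for all $k\in\mathbb{N}$. $AP(g)$ and $UR(g)$ denote the sets of almost periodic and uniformly recurrent points of $g$. *)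

theory Defs
  imports "HOL-Analysis.Analysis"
begin

definition pointwise_periodic_on :: "'a set \<Rightarrow> ('a \<Rightarrow> 'a) \<Rightarrow> bool" where
  "pointwise_periodic_on X f \<longleftrightarrow> (\<forall>x\<in>X. \<exists>n\<ge>1. (f ^^ n) x = x)"

text \<open>The underlying set of \<open>2\<^sup>X\<close>.\<close>

definition hyperspace :: "'a::topological_space set \<Rightarrow> 'a set set" where
  "hyperspace X = {A. closedin (top_of_set X) A \<and> A \<noteq> {}}"

text \<open>The guard makes the distance total: the supremum of an empty or unbounded set of reals
  is unspecified, whereas \<^locale>\<open>Metric_space\<close> requires nonnegativity and symmetry for all
  arguments, also outside the carrier. It never applies to members of \<open>hyperspace X\<close>, \<open>X\<close> compact.\<close>

definition hausdorff_dist :: "'a::metric_space set \<Rightarrow> 'a set \<Rightarrow> real" where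
  "hausdorff_dist A B =
     (if A = {} \<or> B = {} \<or> \<not> bounded A \<or> \<not> bounded B then 0
      else max (SUP a\<in>A. infdist a B) (SUP b\<in>B. infdist b A))"

definition hyperspace_topology :: "'a::metric_space set \<Rightarrow> 'a set topology" where
  "hyperspace_topology X = Metric_space.mtopology (hyperspace X) hausdorff_dist"

definition induced_map :: "('a \<Rightarrow> 'a) \<Rightarrow> 'a set \<Rightarrow> 'a set" where
  "induced_map f A = f ` A"

text \<open>Points whose visits to each neighbourhood have bounded gaps, and points that return to
  each neighbourhood along all multiples of some \<open>N \<ge> 1\<close>. Quantifying over open
  neighbourhoods suffices because both conditions are monotone in \<open>U\<close>.\<close>

definition almost_periodic_points :: "'z topology \<Rightarrow> ('z \<Rightarrow> 'z) \<Rightarrow> 'z set" where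
  "almost_periodic_points Z g =
     {z \<in> topspace Z. \<forall>U. openin Z U \<and> z \<in> U \<longrightarrow>
        (\<exists>N. \<forall>n. {(g ^^ (n + i)) z | i. i \<in> {0..N}} \<inter> U \<noteq> {})}"

definition uniformly_recurrent_points :: "'z topology \<Rightarrow> ('z \<Rightarrow> 'z) \<Rightarrow> 'z set" where
  "uniformly_recurrent_points Z g =
     {z \<in> topspace Z. \<forall>U. openin Z U \<and> z \<in> U \<longrightarrow>
        (\<exists>N\<ge>1. \<forall>k. (g ^^ (k * N)) z \<in> U)}"

lemma infdist_le_hausdorff_dist:
  assumes "A \<noteq> {}" "B \<noteq> {}" "bounded A" "bounded B" "a \<in> A"
  shows "infdist a B \<le> hausdorff_dist A B"
proof -
  obtain b where b: "b \<in> B" using assms by auto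
  obtain e where e: "\<And>x. x \<in> A \<Longrightarrow> dist b x \<le> e"
    using \<open>bounded A\<close> bounded_any_center[of A b] by auto
  have "bdd_above ((\<lambda>a. infdist a B) ` A)"
    by (rule bdd_aboveI2[of _ _ e]) (metis b e dist_commute infdist_le order_trans)
  then have "infdist a B \<le> (SUP a\<in>A. infdist a B)"
    using \<open>a \<in> A\<close> by (rule cSUP_upper2) auto
  then show ?thesis using assms by (auto simp: hausdorff_dist_def)
qed

lemma hausdorff_dist_commute: "hausdorff_dist A B = hausdorff_dist B A"
  by (auto simp: hausdorff_dist_def max.commute)

lemma hausdorff_dist_le:
  assumes "A \<noteq> {}" "B \<noteq> {}" "bounded A" "bounded B"
    and "\<And>a. a \<in> A \<Longrightarrow> infdist a B \<le> c" "\<And>b. b \<in> B \<Longrightarrow> infdist b A \<le> c"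
  shows "hausdorff_dist A B \<le> c"
  using assms by (auto simp: hausdorff_dist_def intro!: cSUP_least)

lemma hausdorff_dist_nonneg: "0 \<le> hausdorff_dist A B"
proof (cases "A = {} \<or> B = {} \<or> \<not> bounded A \<or> \<not> bounded B")
  case True
  then show ?thesis by (auto simp: hausdorff_dist_def)
next
  case False
  then obtain a where "a \<in> A" by auto
  with False infdist_le_hausdorff_dist[of A B a] infdist_nonneg[of a B] show ?thesis by auto
qed

lemma hausdorff_dist_triangle_aux:
  assumes "A \<noteq> {}" "B \<noteq> {}" "C \<noteq> {}" "bounded A" "bounded B" "bounded C" "a \<in> A"
  shows "infdist a C \<le> hausdorff_dist A B + hausdorff_dist B C"
proof (rule field_le_epsilon)
  fix e :: real assume "e > 0"
  have "infdist a B < hausdorff_dist A B + e"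
    using infdist_le_hausdorff_dist[of A B a] assms \<open>e > 0\<close> by auto
  then obtain b where b: "b \<in> B" "dist a b < hausdorff_dist A B + e"
    using assms cINF_less_iff[of B "dist a"] by (auto simp: infdist_notempty)
  have "infdist a C \<le> infdist b C + dist a b" by (rule infdist_triangle)
  also have "infdist b C \<le> hausdorff_dist B C"
    using infdist_le_hausdorff_dist b assms by auto
  finally show "infdist a C \<le> hausdorff_dist A B + hausdorff_dist B C + e" using b by auto
qed

lemma hyperspace_compactD:
  fixes X :: "'a::metric_space set"
  assumes "compact X" "A \<in> hyperspace X"
  shows "A \<noteq> {}" "bounded A" "closed A" "A \<subseteq> X"
proof -
  have cl: "closedin (top_of_set X) A" using assms(2) by (simp add: hyperspace_def)
  show "A \<noteq> {}" using assms(2) by (simp add: hyperspace_def)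
  show "A \<subseteq> X" using closedin_imp_subset[OF cl] .
  then show "bounded A" using assms(1) bounded_subset compact_imp_bounded by blast
  show "closed A" using closedin_closed_trans[OF cl] compact_imp_closed[OF assms(1)] by blast
qed

lemma Metric_space_hyperspace:
  fixes X :: "'a::metric_space set"
  assumes "compact X"
  shows "Metric_space (hyperspace X) hausdorff_dist"
proof
  fix A B C :: "'a set"
  show "0 \<le> hausdorff_dist A B" by (rule hausdorff_dist_nonneg)
  show "hausdorff_dist A B = hausdorff_dist B A" by (rule hausdorff_dist_commute)
  assume A: "A \<in> hyperspace X" and B: "B \<in> hyperspace X"
  note hA = hyperspace_compactD[OF assms A] and hB = hyperspace_compactD[OF assms B]
  have sub: "P \<subseteq> Q" if "hausdorff_dist P Q = 0" "P \<noteq> {}" "Q \<noteq> {}" "bounded P" "bounded Q" "closed Q"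
    for P Q :: "'a set"
  proof
    fix p assume "p \<in> P"
    then have "infdist p Q \<le> 0" using infdist_le_hausdorff_dist[of P Q p] that by auto
    then have "infdist p Q = 0" using infdist_nonneg[of p Q] by linarith
    then show "p \<in> Q" using in_closed_iff_infdist_zero[of Q p] that by auto
  qed
  show "hausdorff_dist A B = 0 \<longleftrightarrow> A = B"
  proof
    assume "hausdorff_dist A B = 0"
    then show "A = B" using sub[of A B] sub[of B A] hA hB hausdorff_dist_commute[of A B] by auto
  next
    assume "A = B"
    then have "hausdorff_dist A B \<le> 0" using hA by (intro hausdorff_dist_le) auto
    then show "hausdorff_dist A B = 0" using hausdorff_dist_nonneg[of A B] by linarith
  qed
  assume C: "C \<in> hyperspace X"
  note hC = hyperspace_compactD[OF assms C]
  show "hausdorff_dist A C \<le> hausdorff_dist A B + hausdorff_dist B C"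
    using hausdorff_dist_triangle_aux[of A B C] hausdorff_dist_triangle_aux[of C B A] hA hB hC
      hausdorff_dist_commute[of A B] hausdorff_dist_commute[of B C]
    by (intro hausdorff_dist_le) (auto simp: add.commute)
qed

lemma topspace_hyperspace_topology:
  "compact X \<Longrightarrow> topspace (hyperspace_topology X) = hyperspace X"
  by (simp add: hyperspace_topology_def Metric_space.topspace_mtopology Metric_space_hyperspace)

lemma induced_map_hyperspace:
  fixes X :: "'a::metric_space set"
  assumes "compact X" "continuous_on X f" "f ` X \<subseteq> X" "A \<in> hyperspace X"
  shows "induced_map f A \<in> hyperspace X"
proof -
  note hA = hyperspace_compactD[OF assms(1,4)]
  have "compact A" using compact_Int_closed[OF assms(1) hA(3)] hA(4) by (simp add: Int_absorb1)
  then have "compact (f ` A)"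
    using compact_continuous_image continuous_on_subset assms(2) hA(4) by blast
  then have "closedin (top_of_set X) (f ` A)"
    using assms(3) hA(4) by (intro closed_subset) (auto intro: compact_imp_closed)
  then show ?thesis using hA(1) by (auto simp: hyperspace_def induced_map_def)
qed

end

theory Submission
  imports Defs
begin

text \<open>Let \<open>A\<close> be almost periodic under \<open>2\<^sup>f\<close> and let \<open>e > 0\<close>. The points of a finite \<open>e\<close>-net of
  \<open>A\<close> have a common period \<open>p\<close>, so \<open>A\<close> lies in the \<open>e\<close>-neighbourhood of \<open>f\<^sup>n(A)\<close> whenever
  \<open>p\<close> divides \<open>n\<close>. Conversely, if for no \<open>N\<close> all \<open>f\<^sup>n(A)\<close> with \<open>N\<close> dividing \<open>n\<close> were in the
  \<open>e\<close>-neighbourhood of \<open>A\<close>, choose offending points \<open>y\<^sub>j\<close> in \<open>f\<^sup>n(A)\<close>, \<open>n\<close> a multiple of \<open>j!\<close>, clustering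
  at some \<open>l\<close> of period \<open>p\<close>. Almost periodicity passes to the \<open>p\<close>-th power of \<open>2\<^sup>f\<close>, so a further
  multiple \<open>i\<close> of \<open>p\<close>, bounded independently of \<open>j\<close>, brings \<open>f\<^sup>n(A)\<close> close to \<open>A\<close>; but
  \<open>f\<^sup>i\<close> moves \<open>y\<^sub>j\<close> only slightly, since it fixes \<open>l\<close>. Hence \<open>y\<^sub>j\<close> is close to \<open>A\<close>, a contradiction.\<close>

section \<open>Return times in a general topological space\<close>

text \<open>The residues modulo \<open>p\<close> of the return times to arbitrarily small neighbourhoods of \<open>z\<close> form a
  subsemigroup of the integers modulo \<open>p\<close>, hence a subgroup, so that a visit with residue \<open>r\<close> can be
  corrected by one with residue \<open>-r\<close>.\<close>

lemma almost_periodic_return_along_multiples: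
  fixes p :: nat
  assumes cont: "continuous_map Z Z g"
    and z: "z \<in> almost_periodic_points Z g"
    and p: "p \<ge> 1"
    and U: "openin Z U" "z \<in> U"
  shows "\<exists>N. \<forall>n. \<exists>i\<le>N. p dvd n + i \<and> (g ^^ (n + i)) z \<in> U"
proof -
  have zZ: "z \<in> topspace Z"
    using z by (simp add: almost_periodic_points_def)
  have contn: "continuous_map Z Z (g ^^ n)" for n
    by (induction n) (auto intro: continuous_map_compose[OF _ cont, unfolded o_def] simp: o_def)
  define vis where "vis r \<longleftrightarrow> (\<forall>V. openin Z V \<and> z \<in> V \<longrightarrow> (\<exists>n. (g ^^ n) z \<in> V \<and> n mod p = r mod p))"
    for r
  have vis0: "vis 0"
    unfolding vis_def by (metis funpow_0)
  have vis_add: "vis (r + s)" if "vis r" "vis s" for r s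
    unfolding vis_def
  proof (intro allI impI)
    fix V assume V: "openin Z V \<and> z \<in> V"
    then obtain n where n: "(g ^^ n) z \<in> V" "n mod p = r mod p"
      using \<open>vis r\<close> unfolding vis_def by blast
    \<comment> \<open>A visit to the pulled-back neighbourhood \<open>W\<close>, followed by
      \<open>n\<close> more steps, ends in \<open>V\<close>; so return times add up.\<close>
    define W where "W = {x \<in> topspace Z. (g ^^ n) x \<in> V}"
    have "openin Z W" "z \<in> W"
      using openin_continuous_map_preimage[OF contn] V n zZ by (auto simp: W_def)
    then obtain m where m: "(g ^^ m) z \<in> W" "m mod p = s mod p"
      using \<open>vis s\<close> unfolding vis_def by blast
    have "(g ^^ (n + m)) z \<in> V"
      using m by (simp add: W_def funpow_add)
    moreover have "(n + m) mod p = (r + s) mod p"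
      using n m by (metis mod_add_cong)
    ultimately show "\<exists>n. (g ^^ n) z \<in> V \<and> n mod p = (r + s) mod p" by blast
  qed
  have vis_mult: "vis (k * r)" if "vis r" for k r
    by (induction k) (auto simp: vis0 vis_add that)
  \<comment> \<open>Modulo \<open>p\<close>, the multiple \<open>(p - 1) * r\<close> is the inverse
    of \<open>r\<close>; closure under addition alone supplies it.\<close>
  have undo: "\<exists>m. (g ^^ m) z \<in> U \<and> p dvd r + m" if r: "vis r" for r
  proof -
    obtain m where m: "(g ^^ m) z \<in> U" "m mod p = ((p - 1) * r) mod p"
      using vis_mult[OF r, of "p - 1"] U unfolding vis_def by blast
    have "(r + m) mod p = (r + (p - 1) * r) mod p"
      using m by (metis mod_add_right_eq)
    also have "r + (p - 1) * r = p * r"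
      using p by (cases p) auto
    finally show ?thesis using m by auto
  qed
  \<comment> \<open>If \<open>r\<close> recurs arbitrarily close to \<open>z\<close>,
    \<open>W\<close> is the preimage of \<open>U\<close> under the correcting power. Otherwise some
    \<open>W\<close> admits no visit with residue \<open>r\<close>, and the implication is
    vacuous.\<close>
  have "\<exists>W m. openin Z W \<and> z \<in> W \<and>
      (\<forall>n. (g ^^ n) z \<in> W \<and> n mod p = r \<longrightarrow> (g ^^ (n + m)) z \<in> U \<and> p dvd n + m)"
    if "r < p" for r
  proof (cases "vis r")
    case True
    then obtain m where m: "(g ^^ m) z \<in> U" "p dvd r + m" using undo by blast
    define W where "W = {x \<in> topspace Z. (g ^^ m) x \<in> U}"
    have W: "openin Z W" "z \<in> W"
      using openin_continuous_map_preimage[OF contn] U m zZ by (auto simp: W_def)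
    have "(g ^^ (n + m)) z \<in> U \<and> p dvd n + m" if "(g ^^ n) z \<in> W \<and> n mod p = r" for n
    proof
      show "(g ^^ (n + m)) z \<in> U"
        using that by (simp add: W_def funpow_add add.commute[of n])
      show "p dvd n + m"
        using that m(2) by (metis mod_add_left_eq dvd_eq_mod_eq_0)
    qed
    with W show ?thesis by blast
  next
    case False
    then show ?thesis using that unfolding vis_def by (metis mod_less)
  qed
  then obtain W m where W: "\<And>r. r < p \<Longrightarrow> openin Z (W r) \<and> z \<in> W r"
    and m: "\<And>r n. \<lbrakk>r < p; (g ^^ n) z \<in> W r; n mod p = r\<rbrakk>
      \<Longrightarrow> (g ^^ (n + m r)) z \<in> U \<and> p dvd n + m r"
    by metis
  define V where "V = (\<Inter>r\<in>{..<p}. W r)"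
  have "openin Z V" "z \<in> V"
    unfolding V_def using W p by (auto intro!: openin_INT2 simp: lessThan_empty_iff)
  then obtain N where N: "\<And>n. {(g ^^ (n + i)) z | i. i \<in> {0..N}} \<inter> V \<noteq> {}"
    using z unfolding almost_periodic_points_def by blast
  \<comment> \<open>A visit to \<open>V\<close> occurs within \<open>N\<close> steps and is then
    corrected according to its residue; the sum is a crude common bound for the corrections.\<close>
  have "\<exists>i\<le>N + (\<Sum>r<p. m r). p dvd n + i \<and> (g ^^ (n + i)) z \<in> U" for n
  proof -
    obtain i where i: "i \<le> N" "(g ^^ (n + i)) z \<in> V" using N[of n] by auto
    define r where "r = (n + i) mod p"
    have r: "r < p" using p by (simp add: r_def)
    have "(g ^^ (n + i)) z \<in> W r"
      using i(2) r unfolding V_def by blast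
    then have "(g ^^ (n + i + m r)) z \<in> U \<and> p dvd n + i + m r"
      by (rule m[OF r _ r_def[symmetric]])
    moreover have "m r \<le> (\<Sum>r<p. m r)" using r by (intro member_le_sum) auto
    ultimately show ?thesis using i(1) by (intro exI[of _ "i + m r"]) (simp add: add.assoc)
  qed
  then show ?thesis by blast
qed

lemma uniformly_recurrent_imp_almost_periodic:
  "uniformly_recurrent_points Z g \<subseteq> almost_periodic_points Z g"
proof
  fix z assume z: "z \<in> uniformly_recurrent_points Z g"
  have "\<exists>N. \<forall>n. {(g ^^ (n + i)) z | i. i \<in> {0..N}} \<inter> U \<noteq> {}"
    if "openin Z U" "z \<in> U" for U
  proof -
    obtain N where N: "N \<ge> 1" "\<And>k. (g ^^ (k * N)) z \<in> U"
      using z \<open>openin Z U\<close> \<open>z \<in> U\<close> by (auto simp: uniformly_recurrent_points_def)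
    have "\<exists>i\<le>N. (g ^^ (n + i)) z \<in> U" for n
    proof -
      \<comment> \<open>Waiting \<open>N - n mod N\<close> steps reaches the next multiple of
        \<open>N\<close>; if \<open>n\<close> is itself a multiple, this is a full round of
        \<open>N\<close> steps, still within the bound.\<close>
      have "n mod N < N" using N by simp
      then have "n + (N - n mod N) = n div N * N + N"
        using div_mult_mod_eq[of n N] by linarith
      also have "\<dots> = Suc (n div N) * N" by simp
      finally have "n + (N - n mod N) = Suc (n div N) * N" .
      with N(2)[of "Suc (n div N)"] show ?thesis
        by (intro exI[of _ "N - n mod N"]) simp
    qed
    then have "{(g ^^ (n + i)) z | i. i \<in> {0..N}} \<inter> U \<noteq> {}" for n
      by fastforce
    then show ?thesis by blast
  qed
  with z show "z \<in> almost_periodic_points Z g"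
    by (auto simp: almost_periodic_points_def uniformly_recurrent_points_def)
qed

section \<open>Continuity of the induced map on the hyperspace\<close>

lemma induced_map_funpow: "(induced_map f ^^ n) A = (f ^^ n) ` A"
  by (induction n) (auto simp: induced_map_def)

lemma funpow_fixed_dvd:
  assumes "(f ^^ p) x = x" "p dvd i"
  shows "(f ^^ i) x = x"
proof -
  obtain k where "i = p * k" using assms(2) by blast
  moreover have "((f ^^ p) ^^ k) x = x" by (induction k) (auto simp: assms(1))
  ultimately show ?thesis by (simp add: funpow_mult mult.commute)
qed

lemma infdist_less_witness:
  assumes "A \<noteq> {}" "infdist x A < e"
  obtains a where "a \<in> A" "dist x a < e"
  using assms cINF_less_iff[of A "dist x"] by (auto simp: infdist_notempty)

text \<open>Transfers a modulus of continuity from points to sets. The strict bound \<open>d\<close>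
  gives each point an actual partner in the other set, even where the infimum is not
  attained.\<close>

lemma hausdorff_dist_image_le:
  assumes "A \<noteq> {}" "B \<noteq> {}" "bounded A" "bounded B" "bounded (f ` A)" "bounded (f ` B)"
    and "hausdorff_dist A B < d"
    and f: "\<And>a b. \<lbrakk>a \<in> A; b \<in> B; dist a b < d\<rbrakk> \<Longrightarrow> dist (f a) (f b) \<le> e"
  shows "hausdorff_dist (f ` A) (f ` B) \<le> e"
proof (rule hausdorff_dist_le)
  fix y assume "y \<in> f ` A"
  then obtain a where a: "a \<in> A" "y = f a" by blast
  have "infdist a B < d" using infdist_le_hausdorff_dist[of A B a] assms a by auto
  then obtain b where "b \<in> B" "dist a b < d" using infdist_less_witness \<open>B \<noteq> {}\<close> by blast
  then show "infdist y (f ` B) \<le> e" using a f infdist_le2[of "f b" "f ` B" y e] by auto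
next
  fix y assume "y \<in> f ` B"
  then obtain b where b: "b \<in> B" "y = f b" by blast
  have "infdist b A < d"
    using infdist_le_hausdorff_dist[of B A b] assms b by (auto simp: hausdorff_dist_commute)
  then obtain a where "a \<in> A" "dist a b < d"
    using infdist_less_witness \<open>A \<noteq> {}\<close> by (metis dist_commute)
  then show "infdist y (f ` A) \<le> e"
    using b f infdist_le2[of "f a" "f ` A" y e] by (auto simp: dist_commute)
qed (use assms in auto)

lemma continuous_map_induced_map:
  assumes "compact X" "continuous_on X f" "f ` X \<subseteq> X"
  shows "continuous_map (hyperspace_topology X) (hyperspace_topology X) (induced_map f)"
proof -
  interpret H: Metric_space "hyperspace X" hausdorff_dist
    by (rule Metric_space_hyperspace[OF assms(1)])
  note hyp = hyperspace_compactD[OF assms(1)]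
  note img = induced_map_hyperspace[OF assms]
  have uc: "uniformly_continuous_on X f"
    using assms compact_uniformly_continuous by blast
  have "\<exists>d>0. \<forall>B. B \<in> hyperspace X \<and> hausdorff_dist A B < d
      \<longrightarrow> hausdorff_dist (induced_map f A) (induced_map f B) < e"
    if A: "A \<in> hyperspace X" and e: "e > 0" for A e
  proof -
    \<comment> \<open>Halving \<open>e\<close> absorbs the passage to a supremum, which preserves
      only the weak inequality.\<close>
    obtain d where d: "d > 0" "\<And>x y. \<lbrakk>x \<in> X; y \<in> X; dist y x < d\<rbrakk> \<Longrightarrow> dist (f y) (f x) < e / 2"
      using uc half_gt_zero[OF e] unfolding uniformly_continuous_on_def by metis
    have "hausdorff_dist (f ` A) (f ` B) \<le> e / 2"
      if B: "B \<in> hyperspace X" "hausdorff_dist A B < d" for B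
    proof (rule hausdorff_dist_image_le[where d = d])
      show "bounded (f ` A)" "bounded (f ` B)"
        using hyp(2)[OF img[OF A]] hyp(2)[OF img[OF B(1)]] by (auto simp: induced_map_def)
      show "dist (f a) (f b) \<le> e / 2" if "a \<in> A" "b \<in> B" "dist a b < d" for a b
        using d(2)[of b a] hyp(4)[OF A] hyp(4)[OF B(1)] that by fastforce
    qed (use B hyp[OF A] hyp[OF B(1)] in auto)
    then show ?thesis
      using d(1) e by (intro exI[of _ d]) (fastforce simp: induced_map_def)
  qed
  then show ?thesis
    unfolding hyperspace_topology_def
    by (subst H.metric_continuous_map[OF H.Metric_space_axioms]) (auto simp: img)
qed

section \<open>The two one-sided Hausdorff estimates\<close>

text \<open>Periods in \<open>A\<close> may be unbounded, so only a finite net is made periodic: its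
  points are fixed by \<open>f ^^ n\<close>, hence lie in the image of \<open>A\<close> as
  well.\<close>

lemma common_period_net:
  assumes "compact A" "pointwise_periodic_on A f" "e > 0"
  obtains p where "p \<ge> 1"
    "\<And>a n. \<lbrakk>a \<in> A; p dvd n\<rbrakk> \<Longrightarrow> infdist a ((f ^^ n) ` A) \<le> e"
proof -
  obtain K where K: "finite K" "K \<subseteq> A" "A \<subseteq> (\<Union>x\<in>K. ball x e)"
    using assms(1,3) seq_compact_imp_totally_bounded compact_imp_seq_compact by metis
  obtain per where per: "\<And>x. x \<in> A \<Longrightarrow> per x \<ge> 1 \<and> (f ^^ per x) x = x"
    using bchoice[OF assms(2)[unfolded pointwise_periodic_on_def]] by blast
  define p where "p = (\<Prod>x\<in>K. per x)"
  have "p \<ge> 1"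
    unfolding p_def by (intro prod_ge_1) (use per K(2) in blast)
  moreover have "infdist a ((f ^^ n) ` A) \<le> e" if "a \<in> A" "p dvd n" for a n
  proof -
    obtain x where x: "x \<in> K" "dist x a < e"
      using K(3) \<open>a \<in> A\<close> by (auto simp: subset_iff)
    have "per x dvd n"
      using dvd_prodI[OF K(1) x(1), of per] \<open>p dvd n\<close> unfolding p_def by (rule dvd_trans)
    then have "(f ^^ n) x = x" using per K(2) x(1) funpow_fixed_dvd by (metis subsetD)
    then have "x \<in> (f ^^ n) ` A" using K(2) x(1) by (metis imageI subsetD)
    then show ?thesis using x(2) by (intro infdist_le2[of x]) (auto simp: dist_commute)
  qed
  ultimately show ?thesis using that by blast
qed

lemma almost_periodic_imp_returns_close:
  assumes "compact X" and cont: "continuous_on X f" and fX: "f ` X \<subseteq> X"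
    and per: "pointwise_periodic_on X f"
    and A: "A \<in> almost_periodic_points (hyperspace_topology X) (induced_map f)"
    and e: "e > 0"
  obtains N where "N \<ge> 1" "\<And>n y. \<lbrakk>N dvd n; y \<in> (f ^^ n) ` A\<rbrakk> \<Longrightarrow> infdist y A < e"
proof (rule ccontr)
  note closeI = that
  assume "\<not> thesis"
  then have "\<exists>n y. N dvd n \<and> y \<in> (f ^^ n) ` A \<and> infdist y A \<ge> e" if "N \<ge> 1" for N
    using closeI[OF that] by (meson not_le)
  \<comment> \<open>The period of the limit point is known only after the sequence is chosen.
    Factorials anticipate it: every \<open>p \<ge> 1\<close> divides \<open>fact j\<close> once
    \<open>j \<ge> p\<close>.\<close>
  then have "\<exists>n y. fact j dvd n \<and> y \<in> (f ^^ n) ` A \<and> infdist y A \<ge> e" for j :: nat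
    by (simp add: fact_ge_1)
  then obtain n y where n: "\<And>j :: nat. fact j dvd n j"
    and y: "\<And>j. y j \<in> (f ^^ n j) ` A" "\<And>j. infdist (y j) A \<ge> e"
    by metis
  interpret H: Metric_space "hyperspace X" hausdorff_dist
    by (rule Metric_space_hyperspace[OF assms(1)])
  have AX: "A \<in> hyperspace X"
    using A by (simp add: almost_periodic_points_def topspace_hyperspace_topology assms(1))
  note hA = hyperspace_compactD[OF assms(1) AX]
  have contn: "continuous_on X (f ^^ i) \<and> (f ^^ i) ` X \<subseteq> X" for i
  proof (induction i)
    case (Suc i)
    then have "continuous_on X (f \<circ> (f ^^ i))"
      by (intro continuous_on_compose continuous_on_subset[OF cont]) auto
    with Suc fX show ?case by (auto simp: image_comp[symmetric] o_def)
  qed auto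
  have yX: "y j \<in> X" for j using y(1)[of j] hA(4) contn by blast
  obtain l s where l: "l \<in> X" and s: "strict_mono s" "(y \<circ> s) \<longlonglongrightarrow> l"
    using assms(1) yX compact_imp_seq_compact seq_compactE by metis
  obtain p where p: "p \<ge> 1" "(f ^^ p) l = l"
    using per l by (auto simp: pointwise_periodic_on_def)
  \<comment> \<open>Three errors below \<open>e / 4\<close> will be added: from \<open>A\<close> to
    the iterate of \<open>y (s j)\<close>, from there to \<open>l\<close>, and from \<open>l\<close>
    to \<open>y (s j)\<close>.\<close>
  define U where "U = H.mball A (e / 4)"
  obtain L where L: "\<And>n. \<exists>i\<le>L. p dvd n + i \<and> (induced_map f ^^ (n + i)) A \<in> U"
    using almost_periodic_return_along_multiples[OF continuous_map_induced_map[OF assms(1) cont fX] A p(1), of U]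
      AX e by (auto simp: U_def hyperspace_topology_def H.openin_mball)
  \<comment> \<open>Since \<open>L\<close> does not depend on \<open>j\<close>, continuity of
    finitely many iterates at \<open>l\<close> suffices. The case \<open>i = 0\<close> is the
    convergence of the points themselves.\<close>
  have "\<forall>\<^sub>F j in sequentially. \<forall>i\<in>{..L}. dist ((f ^^ i) (y (s j))) ((f ^^ i) l) < e / 4"
  proof (intro eventually_ball_finite ballI)
    fix i
    have "((\<lambda>j. (f ^^ i) ((y \<circ> s) j)) \<longlongrightarrow> (f ^^ i) l) sequentially"
      by (rule continuous_on_tendsto_compose[OF _ s(2) l]) (auto simp: contn yX)
    then show "\<forall>\<^sub>F j in sequentially. dist ((f ^^ i) (y (s j))) ((f ^^ i) l) < e / 4"
      using e by (auto dest: tendstoD[where e = "e / 4"])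
  qed auto
  then obtain j where j: "j \<ge> p" "\<And>i. i \<le> L \<Longrightarrow> dist ((f ^^ i) (y (s j))) ((f ^^ i) l) < e / 4"
    unfolding eventually_sequentially by (metis atMost_iff nat_le_linear)
  obtain i where i: "i \<le> L" "p dvd n (s j) + i" "(induced_map f ^^ (n (s j) + i)) A \<in> U"
    using L by blast
  have "p dvd fact (s j)"
    using p(1) j(1) seq_suble[OF s(1), of j] by (intro dvd_fact) auto
  then have "p dvd n (s j)" using n dvd_trans by blast
  then have "p dvd i" using i(2) dvd_add_right_iff by blast
  then have il: "(f ^^ i) l = l" using p(2) funpow_fixed_dvd by metis
  define B where "B = (f ^^ (n (s j) + i)) ` A"
  have B: "B \<in> hyperspace X" "hausdorff_dist A B < e / 4"
    using i(3) by (auto simp: U_def B_def induced_map_funpow)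
  have "(f ^^ i) (y (s j)) \<in> B"
    using y(1)[of "s j"] unfolding B_def add.commute[of "n (s j)"] funpow_add by auto
  then have "infdist ((f ^^ i) (y (s j))) A \<le> hausdorff_dist B A"
    using hA hyperspace_compactD[OF assms(1) B(1)] by (intro infdist_le_hausdorff_dist) auto
  then have "infdist ((f ^^ i) (y (s j))) A < e / 4"
    using B(2) by (simp add: hausdorff_dist_commute)
  then have "infdist l A < e / 2"
    using infdist_triangle[of l A "(f ^^ i) (y (s j))"] j(2)[OF i(1)] il
    by (simp add: dist_commute)
  then have "infdist (y (s j)) A < e"
    using infdist_triangle[of "y (s j)" A l] j(2)[of 0] e by simp
  with y(2)[of "s j"] show False by simp
qed

theorem theorem4p4:
  fixes X :: "'a::metric_space set" and f :: "'a \<Rightarrow> 'a"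
  assumes "compact X"
    and "\<exists>g. homeomorphism X X f g"
    and "pointwise_periodic_on X f"
  shows "almost_periodic_points (hyperspace_topology X) (induced_map f)
       = uniformly_recurrent_points (hyperspace_topology X) (induced_map f)"
proof (intro equalityI uniformly_recurrent_imp_almost_periodic subsetI)
  interpret H: Metric_space "hyperspace X" hausdorff_dist
    by (rule Metric_space_hyperspace[OF assms(1)])
  have cont: "continuous_on X f" and fX: "f ` X \<subseteq> X"
    using assms(2) by (auto simp: homeomorphism_def)
  fix A assume A: "A \<in> almost_periodic_points (hyperspace_topology X) (induced_map f)"
  then have AX: "A \<in> hyperspace X"
    by (simp add: almost_periodic_points_def topspace_hyperspace_topology assms(1))
  note hA = hyperspace_compactD[OF assms(1) AX]
  have "compact A" using assms(1) hA(3,4) compact_Int_closed by (metis inf.absorb2)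
  have hyp_funpow: "(induced_map f ^^ n) A \<in> hyperspace X" for n
    by (induction n) (auto simp: AX induced_map_hyperspace[OF assms(1) cont fX])
  have perA: "pointwise_periodic_on A f"
    using assms(3) hA(4) by (auto simp: pointwise_periodic_on_def)
  have "\<exists>N\<ge>1. \<forall>k. (induced_map f ^^ (k * N)) A \<in> U"
    if U: "openin (hyperspace_topology X) U" "A \<in> U" for U
  proof -
    obtain e where e: "e > 0" "H.mball A e \<subseteq> U"
      using U by (auto simp: hyperspace_topology_def H.openin_mtopology)
    obtain p where p: "p \<ge> 1"
      "\<And>a n. \<lbrakk>a \<in> A; p dvd n\<rbrakk> \<Longrightarrow> infdist a ((f ^^ n) ` A) \<le> e / 2"
      using common_period_net[OF \<open>compact A\<close> perA half_gt_zero[OF e(1)]] by blast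
    obtain q where q: "q \<ge> 1"
      "\<And>n y. \<lbrakk>q dvd n; y \<in> (f ^^ n) ` A\<rbrakk> \<Longrightarrow> infdist y A < e / 2"
      using almost_periodic_imp_returns_close[OF assms(1) cont fX assms(3) A half_gt_zero[OF e(1)]]
      by blast
    \<comment> \<open>Multiples of \<open>p * q\<close> satisfy both one-sided estimates; the bound
      \<open>e / 2\<close> keeps the image inside the open ball of radius \<open>e\<close>.\<close>
    have "(induced_map f ^^ (k * (p * q))) A \<in> U" for k
    proof -
      define B where "B = (f ^^ (k * (p * q))) ` A"
      have BX: "B \<in> hyperspace X"
        unfolding B_def induced_map_funpow[symmetric]
        using hyp_funpow .
      have "infdist a B \<le> e / 2" if "a \<in> A" for a
        unfolding B_def by (rule p(2)[OF that]) simp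
      moreover have "infdist b A \<le> e / 2" if "b \<in> B" for b
        by (rule less_imp_le, rule q(2)[OF _ that[unfolded B_def]]) simp
      ultimately have "hausdorff_dist A B \<le> e / 2"
        using hA hyperspace_compactD[OF assms(1) BX] by (intro hausdorff_dist_le) auto
      then show ?thesis using e AX BX by (auto simp: B_def induced_map_funpow)
    qed
    then show ?thesis using p(1) q(1) by (intro exI[of _ "p * q"]) auto
  qed
  with A show "A \<in> uniformly_recurrent_points (hyperspace_topology X) (induced_map f)"
    by (auto simp: almost_periodic_points_def uniformly_recurrent_points_def)
qed

end
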